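(* Let $n\ge 1$, let $L\in\mathbb{R}^{n\times n}$ be a nominal liability matrix (with zero diagonal), and let $\mathbf{b}=(b_1,\dots,b_n)$ be its net position vector. Let $M\in\mathbb{R}^{n\times n}$ minimize $\mu(M)=\sum_{i=1}^n\sum_{j=1}^n M_{ij}$ subject to $$\sum_{j=1}^n M_{ji}-\sum_{j=1}^n M_{ij}=b_i\quad\text{for all } i\in\{1,\dots,n\},\qquad 0\le M_{ij}\le L_{ij}\quad\text{for all } i,j\in\{1,\dots,n\}.$$ Then $T=L-M$ is a maximum-weight balanced payment subsystem of $L$: $(T,\mathbf{0})$ is a balanced payment subsystem of $L$, and for every balanced payment subsystem $(T',\mathbf{0})$ of $L$ one has $\sum_{i,j}T'_{ij}\le\sum_{i,j}T_{ij}$.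
   Context: A nominal liability matrix is a real $n\times n$ matrix $L$ with zero diagonal, where $L_{ij}$ is the total amount that firm $i$ owes firm $j$. The debt of firm $i$ is $d_i=\sum_{j=1}^n L_{ij}$, its credit is $c_i=\sum_{j=1}^n L_{ji}$, and the net position vector is $\mathbf{b}=\mathbf{c}-\mathbf{d}$. A balanced payment subsystem $(T,\mathbf{0})$ of $L$ is a real $n\times n$ matrix $T$ with $0\le T_{ij}\le L_{ij}$ for all $i,j$ such that, with no external cashflow, every firm's incoming and outgoing payments agree: $\sum_{j}T_{ij}-\sum_{j}T_{ji}=0$ for all $i$. The weight of a network with nominal liability matrix $T$ is the sum of all its obligations, $\sum_{i,j}T_{ij}$. *)

theory Defs
  imports "HOL-Analysis.Analysis"
begin

text \<open>Firms are the elements of a finite type, and \<open>L $ i $ j\<close> is the amount that firm \<open>i\<close> owes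
  firm \<open>j\<close>: row sums are debts and column sums are credits.\<close>

text \<open>Entries are not required to be nonnegative. The bounds \<open>0 \<le> T $ i $ j \<le> L $ i $ j\<close> below
  cannot be satisfied when an entry of \<open>L\<close> is negative.\<close>

definition nominal_liability_matrix :: "real^'n^'n \<Rightarrow> bool" where
  "nominal_liability_matrix L \<longleftrightarrow> (\<forall>i. L $ i $ i = 0)"

definition debt :: "real^'n^'n \<Rightarrow> real^'n" where
  "debt L = (\<chi> i. \<Sum>j\<in>UNIV. L $ i $ j)"

definition credit :: "real^'n^'n \<Rightarrow> real^'n" where
  "credit L = (\<chi> i. \<Sum>j\<in>UNIV. L $ j $ i)"

definition net_position :: "real^'n^'n \<Rightarrow> real^'n" where
  "net_position L = credit L - debt L"

definition network_weight :: "real^'n^'n \<Rightarrow> real" where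
  "network_weight T = (\<Sum>i\<in>UNIV. \<Sum>j\<in>UNIV. T $ i $ j)"

text \<open>\<open>balanced_payment_subsystem L T\<close> says that \<open>(T, 0)\<close> is a balanced payment subsystem of \<open>L\<close>;
  the second component \<open>0\<close> (no external cashflow) is left implicit.\<close>

definition balanced_payment_subsystem :: "real^'n^'n \<Rightarrow> real^'n^'n \<Rightarrow> bool" where
  "balanced_payment_subsystem L T \<longleftrightarrow>
     (\<forall>i j. 0 \<le> T $ i $ j \<and> T $ i $ j \<le> L $ i $ j) \<and>
     (\<forall>i. (\<Sum>j\<in>UNIV. T $ i $ j) - (\<Sum>j\<in>UNIV. T $ j $ i) = 0)"

end

theory Submission
  imports Defs
begin

text \<open>The map \<open>T \<mapsto> L - T\<close> is an involution exchanging the balanced payment subsystems of \<open>L\<close> with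
  the feasible points of the linear program, and it turns the weight into \<open>network_weight L\<close>
  minus the objective, so minimizers correspond to maximum-weight subsystems.\<close>

text \<open>Net positions are linear in the matrix, so \<open>L - T\<close> has the net position of
  \<open>L\<close> exactly when that of \<open>T\<close> vanishes; subtraction from \<open>L\<close>
  swaps the two entrywise bounds.\<close>

lemma balanced_payment_subsystem_iff_residual:
  fixes L T :: "real^'n^'n"
  shows "balanced_payment_subsystem L T \<longleftrightarrow>
    (\<forall>i. (\<Sum>j\<in>UNIV. (L - T) $ j $ i) - (\<Sum>j\<in>UNIV. (L - T) $ i $ j) = net_position L $ i) \<and>
    (\<forall>i j. 0 \<le> (L - T) $ i $ j \<and> (L - T) $ i $ j \<le> L $ i $ j)"
  unfolding balanced_payment_subsystem_def net_position_def credit_def debt_def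
  by (auto simp: sum_subtractf)

lemma network_weight_diff: "network_weight (A - B) = network_weight A - network_weight B"
  by (simp add: network_weight_def sum_subtractf)

theorem corollary15:
  fixes L M :: "real^'n^'n"
  assumes "nominal_liability_matrix L"
    and "is_arg_min (\<lambda>X. \<Sum>i\<in>UNIV. \<Sum>j\<in>UNIV. X $ i $ j)
           (\<lambda>X. (\<forall>i. (\<Sum>j\<in>UNIV. X $ j $ i) - (\<Sum>j\<in>UNIV. X $ i $ j) = net_position L $ i) \<and>
                (\<forall>i j. 0 \<le> X $ i $ j \<and> X $ i $ j \<le> L $ i $ j)) M"
  shows "balanced_payment_subsystem L (L - M) \<and>
         (\<forall>T'. balanced_payment_subsystem L T' \<longrightarrow> network_weight T' \<le> network_weight (L - M))"
proof (intro conjI allI impI)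
  \<comment> \<open>The residual of \<open>L - M\<close> is \<open>M\<close> itself, which is
    feasible.\<close>
  show "balanced_payment_subsystem L (L - M)"
    using assms(2) by (simp add: balanced_payment_subsystem_iff_residual is_arg_min_def)
next
  fix T' :: "real^'n^'n"
  assume "balanced_payment_subsystem L T'"
  \<comment> \<open>\<open>L - T'\<close> is a feasible competitor of \<open>M\<close>; the negated
    form matches \<open>is_arg_min\<close>, which rules out strictly smaller values.\<close>
  then have "\<not> network_weight (L - T') < network_weight M"
    using assms(2)
    unfolding balanced_payment_subsystem_iff_residual is_arg_min_def network_weight_def by blast
  then show "network_weight T' \<le> network_weight (L - M)"
    by (simp add: network_weight_diff)
qed

end
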